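(* Let $\mathbb{F}$ be a field of characteristic not two, let $n \geq 1$, and let $\mathbb{M}_n$ be the set of $n \times n$ matrices over $\mathbb{F}$. A function $\star \colon \mathbb{M}_n \times \mathbb{M}_n \to \mathbb{M}_n$ satisfies all of the properties (A), (B), (I), (T) and (O) if and only if either $x \star y = xy$ for all $x,y \in \mathbb{M}_n$, or $x \star y = yx$ for all $x,y \in \mathbb{M}_n$. Here the properties are: (A) $x \star (y \star z) = (x \star y) \star z$ for all $x,y,z \in \mathbb{M}_n$; (B) $(\lambda x) \star y = \lambda (x \star y) = x \star (\lambda y)$, $(x+y) \star z = (x \star z) + (y \star z)$, and $x \star (y+z) = (x \star y) + (x \star z)$ for all scalars $\lambda \in \mathbb{F}$ and all $x,y,z \in \mathbb{M}_n$; (I) $x \star 1 = x$ for all $x \in \mathbb{M}_n$, where $1 \in \mathbb{M}_n$ is the identity matrix; (T) $\operatorname{Tr}(x \star y) = \operatorname{Tr}(xy)$ for all $x,y \in \mathbb{M}_n$; (O) $x \star y = 0$ whenever $x,y \in \mathbb{M}_n$ have rank one and satisfy $xy = yx = 0$, $xx = x$ and $yy = y$.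
   Context: Juxtaposition $xy$ denotes ordinary matrix multiplication, and $\operatorname{Tr}$ denotes the usual matrix trace. The phrase "either ... or ..." is inclusive (for $n=1$ both alternatives coincide). *)

theory Defs
  imports "HOL-Analysis.Analysis"
begin

abbreviation matrix_scale :: "'a::times \<Rightarrow> 'a^'n^'m \<Rightarrow> 'a^'n^'m" (infixr \<open>*sm\<close> 75)
  where "c *sm A \<equiv> map_matrix (\<lambda>a. c * a) A"

end

theory Submission
  imports Defs
begin

text \<open>
  Associativity turns the trace identity into \<open>Tr ((x \<star> y) \<star> z) = Tr (x (y \<star> z))\<close>, so that
  the trace form is an invariant nondegenerate symmetric form for \<open>\<star>\<close>; in particular the
  right unit is also a left unit. Write \<open>e\<^sub>i\<^sub>j\<close> for the matrix units. By (O), the \<open>e\<^sub>i\<^sub>i\<close> are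
  orthogonal idempotents for \<open>\<star>\<close>, and (O) for perturbed idempotents such as
  \<open>e\<^sub>i\<^sub>i \<plusminus> e\<^sub>i\<^sub>j\<close> and \<open>e\<^sub>j\<^sub>j \<mp> e\<^sub>i\<^sub>j\<close> gives \<open>e\<^sub>i\<^sub>j \<star> e\<^sub>i\<^sub>j = 0\<close> (here the characteristic enters) and
  forces each \<open>e\<^sub>i\<^sub>j\<close> with \<open>i \<noteq> j\<close> into one of the two Peirce components \<open>(i, j)\<close>, \<open>(j, i)\<close>
  of \<open>\<star>\<close>. The trace pairing of \<open>e\<^sub>i\<^sub>j\<close> with \<open>e\<^sub>j\<^sub>i\<close> and one more instance of (O) show that this choice
  is the same for all pairs, and it decides between \<open>xy\<close> and \<open>yx\<close>.
\<close>

section \<open>Outer products and matrix units\<close>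

definition outer :: "'a::times^'m \<Rightarrow> 'a^'n \<Rightarrow> 'a^'n^'m"
  where "outer u v = (\<chi> i j. u $ i * v $ j)"

definition munit :: "'m \<Rightarrow> 'n \<Rightarrow> 'a::zero_neq_one^'n^'m"
  where "munit i j = (\<chi> a b. if a = i \<and> b = j then 1 else 0)"

lemma munit_nth [simp]: "munit i j $ a $ b = (if a = i \<and> b = j then 1 else 0)"
  by (simp add: munit_def)

lemma outer_nth [simp]: "outer u v $ i $ j = u $ i * v $ j"
  by (simp add: outer_def)

lemma outer_mult_outer:
  fixes u :: "'a::comm_semiring_1^'m" and v w :: "'a^'n" and z :: "'a^'k"
  shows "outer u v ** outer w z = (\<Sum>k\<in>UNIV. v $ k * w $ k) *sm outer u z"
  by (simp add: vec_eq_iff matrix_matrix_mult_def sum_distrib_left sum_distrib_right mult_ac)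

lemma rank_outer:
  fixes u :: "'a::field^'m" and v :: "'a^'n"
  assumes "u \<noteq> 0" "v \<noteq> 0"
  shows "rank (outer u v) = 1"
proof -
  have row: "row i (outer u v) = u $ i *s v" for i
    by (simp add: row_def vec_eq_iff)
  from \<open>u \<noteq> 0\<close> obtain k where k: "u $ k \<noteq> 0"
    by (auto simp: vec_eq_iff)
  have "rows (outer u v) \<subseteq> vec.span {v}"
    by (auto simp: rows_def row intro: vec.span_scale vec.span_base)
  moreover have "{v} \<subseteq> vec.span (rows (outer u v))"
  proof -
    have "inverse (u $ k) *s row k (outer u v) \<in> vec.span (rows (outer u v))"
      by (intro vec.span_scale vec.span_base) (auto simp: rows_def)
    with k show ?thesis
      by (simp add: row)
  qed
  ultimately have "vec.span (rows (outer u v)) = vec.span {v}"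
    by (metis vec.span_eq)
  then have "vec.dim (rows (outer u v)) = vec.dim {v}"
    by (rule vec.span_eq_dim)
  also have "\<dots> = 1"
    using \<open>v \<noteq> 0\<close> by (simp add: vec.dim_insert vec.span_empty)
  finally show ?thesis
    by (simp add: row_rank_def_gen)
qed

lemma trace_mult_munit: "trace (x ** munit i j) = (x $ j $ i :: 'a::semiring_1)"
proof -
  have "trace (x ** munit i j)
      = (\<Sum>a\<in>UNIV. \<Sum>k\<in>UNIV. if a = j then if k = i then x $ a $ k else 0 else 0)"
    unfolding trace_def matrix_matrix_mult_def by (intro sum.cong) (auto intro!: sum.cong)
  also have "\<dots> = (\<Sum>a\<in>UNIV. if a = j then x $ a $ i else 0)"
    by (intro sum.cong) auto
  also have "\<dots> = x $ j $ i"
    by simp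
  finally show ?thesis .
qed

text \<open>Nondegeneracy of the trace form: pairing with matrix units reads off every
  entry.\<close>

lemma eq_if_trace_munit_eq:
  fixes x y :: "'a::semiring_1^'n^'n"
  assumes "\<And>i j. trace (x ** munit i j) = trace (y ** munit i j)"
  shows "x = y"
  using assms by (simp add: vec_eq_iff trace_mult_munit)

lemma munit_mult_munit:
  "munit i j ** munit k l = (if j = k then munit i l else (0 :: 'a::semiring_1^_^_))"
proof -
  have "(munit i j ** munit k l) $ a $ b
      = (\<Sum>c\<in>UNIV. if c = j then if a = i \<and> j = k \<and> b = l then 1 else 0 else (0::'a))" for a b
    unfolding matrix_matrix_mult_def vec_lambda_beta munit_nth by (rule sum.cong) auto
  then show ?thesis
    by (auto simp: vec_eq_iff)
qed

lemma sum_munit_diag: "(\<Sum>k\<in>UNIV. munit k k) = (mat 1 :: 'a::semiring_1^'n^'n)"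
proof -
  have "(\<Sum>k\<in>UNIV. munit k k) $ a $ b = (\<Sum>k\<in>UNIV. if k = a then if a = b then 1 else 0 else (0::'a))"
    for a b :: 'n
    unfolding sum_component munit_nth by (rule sum.cong) auto
  then show ?thesis
    by (auto simp: vec_eq_iff mat_def)
qed

section \<open>Products with the same trace form\<close>

text \<open>Both unit laws are assumed so that the assumptions are invariant under exchanging the
  arguments of \<open>star\<close>.\<close>

locale trace_product =
  fixes star :: "'a::field^'n^'n \<Rightarrow> 'a^'n^'n \<Rightarrow> 'a^'n^'n" (infixl \<open>\<star>\<close> 70)
  assumes two: "(2::'a) \<noteq> 0"
    and assoc: "x \<star> (y \<star> z) = (x \<star> y) \<star> z"
    and scale_left: "(c *sm x) \<star> y = c *sm (x \<star> y)"
    and scale_right: "x \<star> (c *sm y) = c *sm (x \<star> y)"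
    and add_left: "(x + y) \<star> z = x \<star> z + y \<star> z"
    and add_right: "x \<star> (y + z) = x \<star> y + x \<star> z"
    and unit_left: "mat 1 \<star> x = x"
    and unit_right: "x \<star> mat 1 = x"
    and trace_star: "trace (x \<star> y) = trace (x ** y)"
    and orth: "\<lbrakk>rank x = 1; rank y = 1; x ** y = 0; y ** x = 0; x ** x = x; y ** y = y\<rbrakk>
      \<Longrightarrow> x \<star> y = 0"
begin

sublocale left: Modules.additive "\<lambda>x. x \<star> y" for y
  by standard (rule add_left)

sublocale right: Modules.additive "\<lambda>y. x \<star> y" for x
  by standard (rule add_right)

lemmas linear_simps = left.add right.add left.diff right.diff left.minus right.minus
  left.zero right.zero

lemma trace_commute: "trace (x \<star> y) = trace (y \<star> x)"
  unfolding trace_star by (rule trace_mul_sym)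

lemma trace_star_munit: "trace (x \<star> munit i j) = x $ j $ i"
  by (simp add: trace_star trace_mult_munit)

text \<open>The first two pairings give idempotence and, being nonzero, rank one; the last two annul
  the matrix products in both orders.\<close>

lemma orth_outer:
  fixes u v w z :: "'a^'n"
  assumes "(\<Sum>k\<in>UNIV. u $ k * v $ k) = 1" "(\<Sum>k\<in>UNIV. w $ k * z $ k) = 1"
    and "(\<Sum>k\<in>UNIV. v $ k * w $ k) = 0" "(\<Sum>k\<in>UNIV. u $ k * z $ k) = 0"
  shows "outer u v \<star> outer w z = 0"
proof -
  have "u \<noteq> 0" "v \<noteq> 0" "w \<noteq> 0" "z \<noteq> 0"
    using assms(1,2) by auto
  then show ?thesis
    using assms
    by (intro orth) (simp_all add: rank_outer outer_mult_outer vec_eq_iff mult.commute)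
qed

abbreviation E :: "'n \<Rightarrow> 'n \<Rightarrow> 'a^'n^'n" where "E \<equiv> munit"

abbreviation ax :: "'n \<Rightarrow> 'a^'n" where "ax i \<equiv> axis i 1"

lemma sum_axis: "(\<Sum>k\<in>UNIV. ax i $ k * x $ k) = x $ i"
proof -
  have "(\<Sum>k\<in>UNIV. ax i $ k * x $ k) = (\<Sum>k\<in>UNIV. if k = i then x $ k else 0)"
    by (intro sum.cong) (auto simp: axis_def)
  then show ?thesis
    by simp
qed

lemmas inner_simps = sum_axis ring_distribs sum.distrib sum_subtractf

lemma outer_axis: "outer (ax i) (ax j) = E i j"
  by (auto simp: vec_eq_iff axis_def)

lemma outer_linear:
  fixes u v w :: "'a^'n"
  shows "outer (u + v) w = outer u w + outer v w" "outer u (v + w) = outer u v + outer u w"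
    "outer (u - v) w = outer u w - outer v w" "outer u (v - w) = outer u v - outer u w"
  by (simp_all add: vec_eq_iff algebra_simps)

section \<open>Peirce components with respect to the diagonal matrix units\<close>

lemma diag_orth:
  assumes "i \<noteq> j"
  shows "E i i \<star> E j j = 0"
  using orth_outer[of "ax i" "ax i" "ax j" "ax j"] assms
  by (simp add: inner_simps outer_axis) (simp add: axis_def)

lemma diag_idem: "E i i \<star> E i i = E i i"
proof -
  have "E i i = E i i \<star> (\<Sum>k\<in>UNIV. E k k)"
    by (simp add: sum_munit_diag unit_right)
  also have "\<dots> = (\<Sum>k\<in>UNIV. E i i \<star> E k k)"
    by (rule right.sum)
  also have "\<dots> = (\<Sum>k\<in>UNIV. if k = i then E i i \<star> E k k else 0)"
    by (intro sum.cong) (auto simp: diag_orth)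
  finally show ?thesis
    by simp
qed

text \<open>For \<open>i \<noteq> j\<close>, (O) applies to \<open>E k k\<close> and the idempotent
  \<open>E i i + E i j\<close>; \<open>diag_orth\<close> removes the diagonal term.\<close>

lemma diag_offdiag:
  assumes "k \<noteq> i" "k \<noteq> j"
  shows "E k k \<star> E i j = 0" "E i j \<star> E k k = 0"
proof -
  show "E k k \<star> E i j = 0"
  proof (cases "i = j")
    case False
    then show ?thesis
      using orth_outer[of "ax k" "ax k" "ax i" "ax i + ax j"] assms
      by (simp add: inner_simps outer_axis outer_linear linear_simps diag_orth) (simp add: axis_def)
  qed (use assms diag_orth in auto)
  show "E i j \<star> E k k = 0"
  proof (cases "i = j")
    case False
    then show ?thesis
      using orth_outer[of "ax i" "ax i + ax j" "ax k" "ax k"] assms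
      by (simp add: inner_simps outer_axis outer_linear linear_simps diag_orth) (simp add: axis_def)
  qed (use assms diag_orth in auto)
qed

lemma offdiag:
  assumes "i \<noteq> j"
  shows offdiag_square: "E i j \<star> E i j = 0"
    and offdiag_right: "E i j \<star> E j j = E i i \<star> E i j"
    and offdiag_left: "E i j \<star> E i i = E j j \<star> E i j"
proof -
  \<comment> \<open>The orthogonal idempotents are \<open>E i i + E i j\<close> and
    \<open>E j j - E i j\<close>; \<open>m\<close> is the same with the sign of \<open>E i j\<close>
    changed. Adding \<open>p\<close> and \<open>m\<close> leaves minus twice the square.\<close>
  have p: "E i j \<star> E j j - E i i \<star> E i j - E i j \<star> E i j = 0"
    using orth_outer[of "ax i" "ax i + ax j" "ax j - ax i" "ax j"] assms
    by (simp add: inner_simps outer_axis outer_linear linear_simps diag_orth)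
      (simp add: axis_def algebra_simps)
  have m: "E i i \<star> E i j - E i j \<star> E j j - E i j \<star> E i j = 0"
    using orth_outer[of "ax i" "ax i - ax j" "ax j + ax i" "ax j"] assms
    by (simp add: inner_simps outer_axis outer_linear linear_simps diag_orth)
      (simp add: axis_def algebra_simps)
  have "E i j \<star> E i j + E i j \<star> E i j = 0"
    using p m by (simp add: algebra_simps)
  then have "2 * (E i j \<star> E i j) $ a $ b = 0" for a b
    unfolding mult_2 by (metis vector_add_component zero_index)
  then show sq: "E i j \<star> E i j = 0"
    using two by (simp add: vec_eq_iff)
  show "E i j \<star> E j j = E i i \<star> E i j"
    using p sq by simp
  \<comment> \<open>The idempotents of \<open>p\<close>, multiplied in the opposite order.\<close>
  show "E i j \<star> E i i = E j j \<star> E i j"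
    using orth_outer[of "ax j - ax i" "ax j" "ax i" "ax i + ax j"] assms sq
    by (simp add: inner_simps outer_axis outer_linear linear_simps diag_orth)
      (simp add: axis_def algebra_simps)
qed

text \<open>Expand the left unit into diagonal units; \<open>diag_offdiag\<close> leaves only the
  indices \<open>i\<close> and \<open>j\<close>.\<close>

lemma offdiag_split:
  assumes "i \<noteq> j"
  shows "E i j = E i i \<star> E i j + E j j \<star> E i j"
proof -
  have "E i j = (\<Sum>k\<in>UNIV. E k k) \<star> E i j"
    by (simp add: sum_munit_diag unit_left)
  also have "\<dots> = (\<Sum>k\<in>UNIV. E k k \<star> E i j)"
    by (rule left.sum)
  also have "\<dots> = (\<Sum>k\<in>{i, j}. E k k \<star> E i j)"
    by (rule sum.mono_neutral_right) (auto simp: diag_offdiag)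
  finally show ?thesis
    using assms by simp
qed

text \<open>The component \<open>E i i \<star> E i j\<close> pairs to zero with every matrix unit
  except \<open>E j i\<close>, hence is a multiple of \<open>E i j\<close>; since left
  multiplication by the idempotent \<open>E i i\<close> fixes it, the factor is its own
  square.\<close>

lemma offdiag_cases:
  assumes "i \<noteq> j"
  shows "E i i \<star> E i j = E i j \<or> E i i \<star> E i j = 0"
proof -
  define a where "a = E i i \<star> E i j"
  have entry: "a $ k $ l = 0" if kl: "\<not> (k = i \<and> l = j)" for k l
  proof -
    have *: "a $ k $ l = trace (a \<star> E l k)"
      by (simp add: trace_star_munit)
    \<comment> \<open>If \<open>i\<close> avoids both indices of \<open>E l k\<close>, cyclicity of
      the trace brings \<open>E i i\<close> next to it; if \<open>j\<close> does, \<open>a\<close>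
      is rewritten as \<open>E i j \<star> E j j\<close>; the remaining position is the transposed
      one, where the square of \<open>E i j\<close> appears.\<close>
    consider "i \<noteq> l" "i \<noteq> k" | "j \<noteq> l" "j \<noteq> k" | "l = i" "k = j"
      using kl assms by metis
    then show ?thesis
    proof cases
      case 1
      have "trace (a \<star> E l k) = trace (E i j \<star> (E l k \<star> E i i))"
        unfolding a_def by (metis assoc trace_commute)
      then show ?thesis
        using 1 * by (simp add: diag_offdiag linear_simps trace_def)
    next
      case 2
      have "a \<star> E l k = E i j \<star> (E j j \<star> E l k)"
        unfolding a_def by (metis assoc offdiag_right assms)
      then show ?thesis
        using 2 * by (simp add: diag_offdiag linear_simps trace_def)
    next
      case 3
      then show ?thesis
        using * assms by (simp add: a_def assoc[symmetric] offdiag_square linear_simps trace_def)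
    qed
  qed
  define c where "c = a $ i $ j"
  have a: "a = c *sm E i j"
    using entry by (auto simp: vec_eq_iff c_def)
  have "a = E i i \<star> a"
    by (simp add: a_def assoc diag_idem)
  also have "\<dots> = c *sm a"
    by (simp add: a scale_right) (simp add: a_def[symmetric] a)
  finally have "c = c * c"
    by (metis c_def nth_map_matrix)
  then have "c = 1 \<or> c = 0"
    by auto
  then show ?thesis
    using a by (auto simp: a_def[symmetric] vec_eq_iff)
qed

section \<open>Straight units, \<open>E i i \<star> E i j = E i j\<close>: one off-diagonal instance
  forces all\<close>

lemma straight_sym:
  assumes "i \<noteq> j" "E i i \<star> E i j = E i j"
  shows "E j j \<star> E j i = E j i"
proof (rule ccontr)
  assume "\<not> ?thesis"
  then have "E j j \<star> E j i = 0"
    using offdiag_cases[of j i] assms by auto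
  \<comment> \<open>Straightness and \<open>offdiag_right\<close> let \<open>E i j\<close> absorb
    \<open>E j j\<close> on its right, so this product vanishes, although (T) gives it trace
    one.\<close>
  then have "E i j \<star> E j i = 0"
    by (metis assoc offdiag_right assms right.zero)
  then have "trace (E i j \<star> E j i) = 0"
    by (simp add: trace_def)
  then show False
    by (simp add: trace_star_munit)
qed

text \<open>Multiplying an instance of (O) on the left by \<open>E j j\<close> isolates
  \<open>E j j \<star> E k j\<close>, the reversed component of \<open>E k j\<close>.\<close>

lemma straight_col:
  assumes "i \<noteq> j" "k \<noteq> j" "E i i \<star> E i j = E i j"
  shows "E k k \<star> E k j = E k j"
proof (cases "k = i")
  case False
  \<comment> \<open>The covector \<open>ax k + ax i - ax j\<close> is chosen to vanish on
    \<open>ax j + ax i\<close>.\<close>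
  have 0: "(E j j + E i j) \<star> (E k k + E k i - E k j) = 0"
    using orth_outer[of "ax j + ax i" "ax j" "ax k" "ax k + ax i - ax j"] assms False
    by (simp add: inner_simps outer_axis outer_linear)
      (simp add: axis_def)
  have "E j j \<star> E i j = 0"
    using offdiag_split[of i j] assms by simp
  then have "E j j = E j j \<star> (E j j + E i j)"
    by (simp add: linear_simps diag_idem)
  then have "E j j \<star> (E k k + E k i - E k j) = 0"
    by (metis 0 assoc right.zero)
  then have "E j j \<star> E k j = 0"
    using assms False by (simp add: linear_simps diag_offdiag)
  then show ?thesis
    using offdiag_split[of k j] assms by simp
qed (use assms in auto)

text \<open>Transposing with \<open>straight_sym\<close> before and after turns column propagation
  into row propagation; together they reach any pair.\<close>

lemma straight_all:
  assumes "i \<noteq> j" "E i i \<star> E i j = E i j"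
  shows "E k k \<star> E k l = E k l"
proof (cases "k = l")
  case False
  have row: "E a a \<star> E a c = E a c" if "a \<noteq> b" "a \<noteq> c" "E a a \<star> E a b = E a b" for a b c
    using that by (metis straight_sym straight_col)
  show ?thesis
  proof (cases "l = i")
    case True
    then show ?thesis
      using assms False by (metis straight_sym straight_col)
  next
    case l: False
    then have "E i i \<star> E i l = E i l"
      using row assms by metis
    then show ?thesis
      using straight_col l False by metis
  qed
qed (simp add: diag_idem)

section \<open>The straight case is the matrix product\<close>

lemma straight_imp_matrix_mult:
  assumes straight: "\<And>i j. E i i \<star> E i j = E i j"
  shows "x \<star> y = x ** y"
proof -
  have rt: "E i j \<star> E j j = E i j" for i j
    by (cases "i = j") (simp_all add: diag_idem offdiag_right straight)
  have lt0: "E k k \<star> E i j = 0" if "k \<noteq> i" for i j k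
    by (metis assoc diag_orth left.zero straight that)
  have rt0: "E i j \<star> E k k = 0" if "k \<noteq> j" for i j k
    by (metis assoc diag_orth right.zero rt that)
  have E0: "E i j \<star> E k l = 0" if "j \<noteq> k" for i j k l
    by (metis assoc rt0 left.zero straight that)
  \<comment> \<open>Products of mismatched units vanish by \<open>E0\<close>, so only the entry at
    \<open>i\<close>, \<open>i\<close> survives, and (T) gives its value.\<close>
  have corner: "E i j \<star> E j i = E i i" if "i \<noteq> j" for i j
  proof -
    define u where "u = E i j \<star> E j i"
    have "u $ k $ l = E i i $ k $ l" for k l
    proof -
      have *: "u $ k $ l = trace (u \<star> E l k)"
        by (simp add: trace_star_munit)
      consider "l \<noteq> i" | "k \<noteq> i" | "k = i" "l = i"
        by auto
      then show ?thesis
      proof cases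
        case 1
        then have "u \<star> E l k = 0"
          by (simp add: u_def assoc[symmetric] E0 linear_simps)
        then show ?thesis
          using 1 * by (simp add: trace_def)
      next
        case 2
        then have "E l k \<star> u = 0"
          by (simp add: u_def assoc E0 linear_simps)
        then show ?thesis
          using 2 * trace_commute[of u "E l k"] by (simp add: trace_def)
      next
        case 3
        have "u \<star> E i i = u"
          by (simp add: u_def assoc[symmetric] rt)
        then show ?thesis
          using 3 * by (simp add: u_def trace_star_munit)
      qed
    qed
    then show ?thesis
      by (simp add: vec_eq_iff u_def)
  qed
  have chain: "E i j \<star> E j l = E i l" if "i \<noteq> j" "j \<noteq> l" "i \<noteq> l" for i j l
  proof -
    \<comment> \<open>The signs make the two idempotents orthogonal; after \<open>E0\<close> only
      \<open>E i j \<star> E j l - E i l \<star> E l l\<close> remains.\<close>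
    have "(E i i + E i j - E i l) \<star> (E l l + E j l) = 0"
      using orth_outer[of "ax i" "ax i + ax j - ax l" "ax l + ax j" "ax l"] that
      by (simp add: inner_simps outer_axis outer_linear) (simp add: axis_def)
    then show ?thesis
      using that by (simp add: linear_simps E0 rt)
  qed
  have E1: "E i j \<star> E j l = E i l" for i j l
    by (cases "i = j"; cases "j = l"; cases "i = l")
      (auto simp: straight rt corner chain diag_idem)
  have EE: "E i j \<star> E k l = E i j ** E k l" for i j k l
    by (simp add: munit_mult_munit E0 E1)
  \<comment> \<open>Invariance of the trace form reduces this to \<open>EE\<close>, and
    nondegeneracy removes the test matrix \<open>E k l\<close>; the same argument then uses
    \<open>yE\<close> to free the second factor.\<close>
  have yE: "y \<star> E i j = y ** E i j" for i j and y
  proof (rule eq_if_trace_munit_eq)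
    fix k l
    have "trace (y \<star> E i j ** E k l) = trace (y \<star> (E i j \<star> E k l))"
      by (simp add: trace_star[symmetric] assoc)
    also have "\<dots> = trace (y ** (E i j ** E k l))"
      by (simp add: trace_star EE)
    finally show "trace (y \<star> E i j ** E k l) = trace (y ** E i j ** E k l)"
      by (simp add: matrix_mul_assoc)
  qed
  show ?thesis
  proof (rule eq_if_trace_munit_eq)
    fix k l
    have "trace (x \<star> y ** E k l) = trace (x \<star> (y \<star> E k l))"
      by (simp add: trace_star[symmetric] assoc)
    also have "\<dots> = trace (x ** (y ** E k l))"
      by (simp add: trace_star yE)
    finally show "trace (x \<star> y ** E k l) = trace (x ** y ** E k l)"
      by (simp add: matrix_mul_assoc)
  qed
qed

end

section \<open>The opposite product and the equivalence\<close>

lemma trace_product_opposite: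
  assumes "trace_product star"
  shows "trace_product (\<lambda>x y. star y x)"
proof -
  interpret trace_product star
    by (rule assms)
  show ?thesis
  proof
    show "trace (star y x) = trace (x ** y)" for x y
      unfolding trace_star by (rule trace_mul_sym)
  qed (simp_all add: two assoc scale_left scale_right linear_simps unit_left unit_right orth)
qed

lemma trace_product_cases:
  assumes "trace_product star"
  shows "(\<forall>x y. star x y = x ** y) \<or> (\<forall>x y. star x y = y ** x)"
proof -
  interpret trace_product star
    by (rule assms)
  interpret opp: trace_product "\<lambda>x y. star y x"
    by (rule trace_product_opposite) (rule assms)
  show ?thesis
  proof (cases "\<forall>i j. star (E i i) (E i j) = E i j")
    case True
    then show ?thesis
      using straight_imp_matrix_mult by blast
  next
    case False
    \<comment> \<open>By \<open>straight_all\<close>, one failure rules out every off-diagonal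
      straight unit, so \<open>offdiag_split\<close> and \<open>offdiag_left\<close> put them all in
      the reversed component, which is straightness for the opposite product.\<close>
    have "star (E i j) (E i i) = E i j" for i j
    proof (cases "i = j")
      case ij: False
      then have "star (E i i) (E i j) = 0"
        using False offdiag_cases straight_all by blast
      then show ?thesis
        using ij offdiag_left offdiag_split by (metis add_0)
    qed (simp add: diag_idem)
    then show ?thesis
      using opp.straight_imp_matrix_mult by blast
  qed
qed

theorem theorem1:
  fixes star :: "'a::field^'n^'n \<Rightarrow> 'a^'n^'n \<Rightarrow> 'a^'n^'n" (infixl \<open>\<star>\<close> 70)
  assumes "CHAR('a) \<noteq> 2"
  shows
    "((\<forall>x y z. x \<star> (y \<star> z) = (x \<star> y) \<star> z) \<and>
      ((\<forall>c x y. (c *sm x) \<star> y = c *sm (x \<star> y) \<and> c *sm (x \<star> y) = x \<star> (c *sm y)) \<and>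
       (\<forall>x y z. (x + y) \<star> z = (x \<star> z) + (y \<star> z)) \<and>
       (\<forall>x y z. x \<star> (y + z) = (x \<star> y) + (x \<star> z))) \<and>
      (\<forall>x. x \<star> mat 1 = x) \<and>
      (\<forall>x y. trace (x \<star> y) = trace (x ** y)) \<and>
      (\<forall>x y. rank x = 1 \<and> rank y = 1 \<and> x ** y = 0 \<and> y ** x = 0 \<and> x ** x = x \<and> y ** y = y
         \<longrightarrow> x \<star> y = 0))
     \<longleftrightarrow> (\<forall>x y. x \<star> y = x ** y) \<or> (\<forall>x y. x \<star> y = y ** x)"
  (is "?axioms \<longleftrightarrow> ?products")
proof
  assume ax: ?axioms
  \<comment> \<open>A divisor of the prime two is one or two, and a field cannot have characteristic
    one.\<close>
  have "\<not> CHAR('a) dvd 2"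
    using assms two_is_prime_nat CHAR_not_1'[where 'a = 'a] by (auto simp: prime_nat_iff)
  then have two: "(2::'a) \<noteq> 0"
    using of_nat_eq_0_iff_char_dvd[of 2, where 'a = 'a] by simp
  \<comment> \<open>By associativity and (T), the trace on the left is that of
    \<open>mat 1 ** (x \<star> munit i j)\<close>.\<close>
  have unit_left: "mat 1 \<star> x = x" for x
  proof (rule eq_if_trace_munit_eq)
    fix i j
    show "trace (mat 1 \<star> x ** munit i j) = trace (x ** munit i j)"
      using ax by (metis matrix_mul_lid)
  qed
  have "trace_product (\<star>)"
    by standard (use ax two unit_left in \<open>simp_all\<close>)
  then show ?products
    by (rule trace_product_cases)
next
  have add: "(x + y) ** z = x ** z + y ** z" for x y z :: "'a^'n^'n"
    by (simp add: vec_eq_iff matrix_matrix_mult_def distrib_right sum.distrib)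
  have scale: "(c *sm x) ** y = c *sm (x ** y)" "x ** (c *sm y) = c *sm (x ** y)"
    for c and x y :: "'a^'n^'n"
    by (simp_all add: vec_eq_iff matrix_matrix_mult_def sum_distrib_left mult_ac)
  assume ?products
  then show ?axioms
  proof
    assume "\<forall>x y. x \<star> y = x ** y"
    then show ?thesis
      by (simp add: add scale matrix_mul_assoc matrix_add_ldistrib)
  next
    assume "\<forall>x y. x \<star> y = y ** x"
    moreover have "trace (y ** x) = trace (x ** y)" for x y :: "'a^'n^'n"
      by (rule trace_mul_sym)
    ultimately show ?thesis
      by (simp add: add scale matrix_mul_assoc matrix_add_ldistrib)
  qed
qed

end
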